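(* For any $c_0\in\mathbb{R}$ and $\lambda\in\mathcal{M}_+(S^1)$, there are unique $\zeta_0\in\mathbb{R}$ and $\mu\in\mathcal{M}_+(S^1)$ such that $$Q_{c_0}[\lambda](z)\,Q_{\zeta_0}[\mu](z)= 1\qquad\text{for all } z\in\mathbb{D}.$$ Write $\mathcal{B}[\lambda,c_0]=(\mu,\zeta_0)$. The map $\mathcal{B}$ is an involution of $\mathcal{M}_+(S^1)\times\mathbb{R}$, and it is continuous with respect to the product of the weak topology on $\mathcal{M}_+(S^1)$ and the standard topology on $\mathbb{R}$. Moreover, $(\|\lambda\|+ic_0)(\|\mu\|+i\zeta_0)=1$, where $\|\cdot\|$ is the total variation norm.
   Context: $\mathbb{D}\subset\mathbb{C}$ is the open unit disc and $S^1$ the unit circle. $\mathcal{M}_+(S^1)$ is the set of finite non-negative Borel measures on $S^1$, excluding the zero measure; its weak topology is that of convergence of integrals against continuous functions on $S^1$. For $\lambda\in\mathcal{M}_+(S^1)$ and $\sigma\in\mathbb{R}$, the $\sigma$-Cauchy transform is the holomorphic function on $\mathbb{D}$ $$Q_\sigma[\lambda](z)=\int_0^{2\pi}\frac{1+e^{-i\theta}z}{1-e^{-i\theta}z}\,d\lambda(\theta)+i\sigma .$$ *)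

theory Defs
  imports "HOL-Analysis.Analysis"
begin

abbreviation circle :: "complex set" where
  "circle \<equiv> sphere 0 1"

abbreviation borel_circle :: "complex measure" where
  "borel_circle \<equiv> restrict_space borel circle"

definition M_plus :: "complex measure set" where
  "M_plus = {M. sets M = sets borel_circle \<and> finite_measure M \<and> M \<noteq> null_measure borel_circle}"

text \<open>The weak topology is the initial topology on \<open>M_plus\<close> for the maps sending \<open>M\<close> to the
  integral of \<open>f\<close>, with \<open>f\<close> continuous on the circle. Its carrier is \<open>M_plus\<close>.\<close>

definition weak_topology :: "complex measure topology" where
  "weak_topology = topology_generated_by
     {{M \<in> M_plus. (\<integral>w. f w \<partial>M) \<in> U} | (f :: complex \<Rightarrow> real) U.
        continuous_on circle f \<and> open U}"

text \<open>A measure on the circle lives on the points \<open>w = exp (i \<theta>)\<close>, so \<open>exp (- i \<theta>)\<close> is \<open>cnj w\<close>.\<close>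

definition cauchy_transform :: "real \<Rightarrow> complex measure \<Rightarrow> complex \<Rightarrow> complex" where
  "cauchy_transform \<sigma> M z =
     (\<integral>w. (1 + cnj w * z) / (1 - cnj w * z) \<partial>M) + \<i> * complex_of_real \<sigma>"

definition inverse_pair :: "complex measure \<times> real \<Rightarrow> complex measure \<times> real \<Rightarrow> bool" where
  "inverse_pair = (\<lambda>(l, c) (m, \<zeta>).
     \<forall>z \<in> ball 0 1. cauchy_transform c l z * cauchy_transform \<zeta> m z = 1)"

definition B_map :: "complex measure \<times> real \<Rightarrow> complex measure \<times> real" where
  "B_map p = (THE q. q \<in> M_plus \<times> UNIV \<and> inverse_pair p q)"

definition tv_norm :: "'a measure \<Rightarrow> real" where
  "tv_norm M = Sup {\<Sum>A\<in>P. \<bar>measure M A\<bar> | P.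
     finite P \<and> P \<subseteq> sets M \<and> partition_on (space M) P}"

lemma topspace_weak_topology: "topspace weak_topology = M_plus"
proof -
  have "M_plus \<in> {{M \<in> M_plus. (\<integral>w. f w \<partial>M) \<in> U} | (f :: complex \<Rightarrow> real) U.
        continuous_on circle f \<and> open U}"
    by (rule CollectI, rule exI[of _ "\<lambda>_. 0"], rule exI[of _ UNIV]) auto
  then show ?thesis
    unfolding weak_topology_def topology_generated_by_topspace by blast
qed

end

theory Submission
  imports Defs "HOL-Probability.Helly_Selection" "HOL-Complex_Analysis.Complex_Analysis"
begin

text \<open>
  The integrand of the Cauchy transform is the Herglotz kernel \<open>(w + z) / (w - z)\<close> of the point
  \<open>w\<close> of the circle; its real part is the Poisson kernel and hence positive. Cauchy transforms
  therefore have positive real part on the disc. Herglotz's theorem is the converse: a holomorphic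
  function on the disc with positive real part is a Cauchy transform. As inversion preserves the
  right half plane, \<open>1 / Q\<close> is again a Cauchy transform, which is the existence half of the
  theorem (\<open>inverse_pair_exists\<close>, from \<open>Herglotz_representation\<close>).

  Everything else is read off from Taylor coefficients. Expanding the kernel in a geometric series
  shows that the coefficients of the Cauchy transform of \<open>M\<close> are
  \<open>\<parallel>M\<parallel> + i \<sigma>\<close> at \<open>0\<close> and twice the \<open>n\<close>-th moment (the integral of \<open>(cnj w) ^ n\<close>) at
  \<open>n > 0\<close>. Two pairs are inverse to each other only if their power series are, and a power series
  has at most one inverse; so the uniqueness of \<open>\<mu>\<close> amounts to the fact that moments
  determine a measure. That fact and the continuity of the map have one common source,
  \<open>moments_tendsto_imp_integral_tendsto\<close>: convergence of all moments, along any filter,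
  implies convergence of the integrals of all continuous functions, because trigonometric
  polynomials are uniformly dense. Continuity follows since each coefficient of the
  inverse series is a rational expression in finitely many coefficients of the series
  (\<open>fps_inverse_coeff_tendsto\<close>). The inverse relation is symmetric, so the map is an
  involution, and the norm identity is the equation \<open>Q \<cdot> Q' = 1\<close> at \<open>z = 0\<close>.

  The measure in Herglotz's theorem is a weak limit of the measures on the circle with densities
  \<open>Re (f (r w))\<close> as \<open>r\<close> tends to \<open>1\<close>. The moments of these are known from Cauchy's
  integral formula, and a limit exists by Helly's selection theorem, applied after
  parametrising the circle by \<open>[0, 1]\<close>.
\<close>

unbundle no vec_syntax

section \<open>Measures on the circle and their moments\<close>

lemma M_plus_D:
  assumes "M \<in> M_plus"
  shows "finite_measure M" "sets M = sets borel_circle" "space M = circle"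
  using assms sets_eq_imp_space_eq[of M borel_circle] by (auto simp: M_plus_def space_restrict_space)

lemma borel_measurable_continuous_on_circle:
  assumes "M \<in> M_plus" "continuous_on circle f"
  shows "f \<in> borel_measurable M"
  using borel_measurable_continuous_on_restrict[OF assms(2)]
    measurable_cong_sets[OF M_plus_D(2)[OF assms(1)] refl] by blast

lemma integrable_continuous_on_circle:
  fixes f :: "complex \<Rightarrow> 'b::{banach,second_countable_topology}"
  assumes M: "M \<in> M_plus" and f: "continuous_on circle f"
  shows "integrable M f"
proof -
  interpret finite_measure M by (rule M_plus_D(1)[OF M])
  have "bounded (f ` circle)"
    using f by (intro compact_imp_bounded compact_continuous_image) auto
  then obtain B where "\<And>w. w \<in> circle \<Longrightarrow> norm (f w) \<le> B"
    unfolding bounded_iff by (metis imageI)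
  then show ?thesis
    using borel_measurable_continuous_on_circle[OF M f] M_plus_D(3)[OF M]
    by (intro integrable_const_bound[of _ B]) auto
qed

lemma mass_pos:
  assumes M: "M \<in> M_plus"
  shows "measure M (space M) > 0"
proof (rule ccontr)
  interpret finite_measure M by (rule M_plus_D(1)[OF M])
  assume "\<not> ?thesis"
  then have 0: "emeasure M (space M) = 0"
    by (simp add: emeasure_eq_measure zero_less_measure_iff)
  have "M = null_measure borel_circle"
  proof (rule measure_eqI)
    show "sets M = sets (null_measure borel_circle)" using M_plus_D(2)[OF M] by simp
    show "emeasure M A = emeasure (null_measure borel_circle) A" if "A \<in> sets M" for A
      using that 0 by (metis emeasure_null_measure emeasure_space le_zero_eq)
  qed
  then show False using M by (simp add: M_plus_def)
qed

definition moment :: "complex measure \<Rightarrow> nat \<Rightarrow> complex" where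
  "moment M n = (\<integral>w. cnj w ^ n \<partial>M)"

lemma moment_0: "moment M 0 = of_real (measure M (space M))"
  by (simp add: moment_def of_real_def)

text \<open>On a positive measure, finite additivity gives every partition the same sum, so that
  the supremum is over a singleton. It is non-empty because \<open>{circle}\<close> is a partition.\<close>
lemma tv_norm_eq_mass:
  assumes M: "M \<in> M_plus"
  shows "tv_norm M = measure M (space M)"
proof -
  interpret finite_measure M by (rule M_plus_D(1)[OF M])
  have *: "(\<Sum>A\<in>P. \<bar>measure M A\<bar>) = measure M (space M)"
    if P: "finite P" "P \<subseteq> sets M" "partition_on (space M) P" for P
  proof -
    have "measure M (\<Union>A\<in>P. A) = (\<Sum>A\<in>P. measure M A)"
      using P by (intro finite_measure_finite_Union)
        (auto simp: partition_on_def disjoint_family_on_def disjoint_def)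
    then show ?thesis using P by (simp add: partition_on_def)
  qed
  have "space M \<noteq> {}" using M_plus_D(3)[OF M] by simp
  then have "partition_on (space M) {space M}" by (auto intro: partition_onI)
  then have "{\<Sum>A\<in>P. \<bar>measure M A\<bar> | P. finite P \<and> P \<subseteq> sets M \<and> partition_on (space M) P}
      = {measure M (space M)}"
    using * by (auto intro!: exI[of _ "{space M}"])
  then show ?thesis by (simp add: tv_norm_def)
qed

section \<open>The Cauchy transform as a power series\<close>

definition cauchy_fps :: "real \<Rightarrow> complex measure \<Rightarrow> complex fps" where
  "cauchy_fps \<sigma> M =
     Abs_fps (\<lambda>n. if n = 0 then Complex (measure M (space M)) \<sigma> else 2 * moment M n)"

lemma cauchy_fps_nth_0: "cauchy_fps \<sigma> M $ 0 = Complex (measure M (space M)) \<sigma>"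
  by (simp add: cauchy_fps_def)

lemma cauchy_fps_nth: "n > 0 \<Longrightarrow> cauchy_fps \<sigma> M $ n = 2 * moment M n"
  by (simp add: cauchy_fps_def)

text \<open>This is the geometric series of \<open>2 / (1 - u) - 1\<close>.\<close>
lemma circle_kernel_sums:
  fixes u :: complex
  assumes "norm u < 1"
  shows "(\<lambda>n. if n = 0 then 1 else 2 * u ^ n) sums ((1 + u) / (1 - u))"
proof -
  have "(\<lambda>n. 2 * u ^ n - (if n = 0 then 1 else 0)) sums (2 * (1 / (1 - u)) - 1)"
    by (intro sums_diff sums_mult geometric_sums assms sums_single)
  moreover have "2 * (1 / (1 - u)) - 1 = (1 + u) / (1 - u)"
  proof -
    have "u \<noteq> 1" using assms by auto
    then show ?thesis by (simp add: divide_simps)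
  qed
  moreover have "(\<lambda>n. 2 * u ^ n - (if n = 0 then 1 else 0)) = (\<lambda>n. if n = 0 then 1 else 2 * u ^ n)"
    by auto
  ultimately show ?thesis by simp
qed

text \<open>The expansion of the kernel converges uniformly on the circle for fixed \<open>z\<close>, dominated by
  \<open>2 * norm z ^ n\<close>, and can be integrated term by term.\<close>
lemma cauchy_transform_sums:
  assumes M: "M \<in> M_plus" and z: "norm z < 1"
  shows "(\<lambda>n. cauchy_fps \<sigma> M $ n * z ^ n) sums cauchy_transform \<sigma> M z"
proof -
  interpret finite_measure M by (rule M_plus_D(1)[OF M])
  define g where "g n w = (if n = 0 then 1 else 2 * (cnj w * z) ^ n)" for n w
  have cont: "continuous_on circle (g n)" for n
    unfolding g_def by (cases "n = 0") (auto intro!: continuous_intros)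
  have bound: "norm (g n w) \<le> 2 * norm z ^ n" if "w \<in> circle" for n w
    using that by (auto simp: g_def norm_mult norm_power)
  have summ: "summable (\<lambda>n. 2 * norm z ^ n)"
    using z by (intro summable_mult summable_geometric) auto
  have "(\<lambda>n. integral\<^sup>L M (g n)) sums (\<integral>w. (\<Sum>n. g n w) \<partial>M)"
  proof (rule sums_integral)
    show "integrable M (g n)" for n by (rule integrable_continuous_on_circle[OF M cont])
    show "AE w in M. summable (\<lambda>n. norm (g n w))"
      using bound M_plus_D(3)[OF M]
      by (intro AE_I2 summable_comparison_test'[OF summ, of 0]) auto
    show "summable (\<lambda>n. \<integral>w. norm (g n w) \<partial>M)"
    proof (rule summable_comparison_test'[of _ 0])
      show "summable (\<lambda>n. 2 * norm z ^ n * measure M (space M))"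
        using summ by (rule summable_mult2)
      show "norm (\<integral>w. norm (g n w) \<partial>M) \<le> 2 * norm z ^ n * measure M (space M)" for n
      proof -
        have "(\<integral>w. norm (g n w) \<partial>M) \<le> (\<integral>w. 2 * norm z ^ n \<partial>M)"
          using bound M_plus_D(3)[OF M] integrable_continuous_on_circle[OF M cont]
          by (intro integral_mono) auto
        then show ?thesis by (simp add: mult_ac)
      qed
    qed
  qed
  also have "(\<integral>w. (\<Sum>n. g n w) \<partial>M) = (\<integral>w. (1 + cnj w * z) / (1 - cnj w * z) \<partial>M)"
  proof (rule Bochner_Integration.integral_cong[OF refl])
    fix w assume "w \<in> space M"
    then have "norm (cnj w * z) < 1" using z M_plus_D(3)[OF M] by (simp add: norm_mult)
    from circle_kernel_sums[OF this] show "(\<Sum>n. g n w) = (1 + cnj w * z) / (1 - cnj w * z)"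
      unfolding g_def by (rule sums_unique[symmetric])
  qed
  finally have "(\<lambda>n. integral\<^sup>L M (g n) + (if n = 0 then \<i> * of_real \<sigma> else 0))
      sums cauchy_transform \<sigma> M z"
    unfolding cauchy_transform_def by (intro sums_add sums_single)
  moreover have "integral\<^sup>L M (g n) + (if n = 0 then \<i> * of_real \<sigma> else 0)
      = cauchy_fps \<sigma> M $ n * z ^ n" for n
  proof (cases "n = 0")
    case True
    then have "g n = (\<lambda>_. 1)" by (simp add: g_def fun_eq_iff)
    then show ?thesis using True
      by (simp add: cauchy_fps_nth_0 complex_eq_iff)
  next
    case False
    then have "g n = (\<lambda>w. cnj w ^ n * (2 * z ^ n))"
      by (auto simp: g_def power_mult_distrib)
    then show ?thesis using False by (simp add: cauchy_fps_nth moment_def mult_ac)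
  qed
  ultimately show ?thesis by simp
qed

lemma cauchy_transform_0:
  assumes "M \<in> M_plus"
  shows "cauchy_transform \<sigma> M 0 = Complex (measure M (space M)) \<sigma>"
  using cauchy_transform_sums[OF assms, of 0 \<sigma>] powser_sums_zero[of "fps_nth (cauchy_fps \<sigma> M)"]
  by (auto simp: cauchy_fps_nth_0 dest: sums_unique2)

lemma has_fps_expansion_cauchy_transform:
  assumes "M \<in> M_plus"
  shows "cauchy_transform \<sigma> M has_fps_expansion cauchy_fps \<sigma> M"
proof (rule has_fps_expansionI)
  have "eventually (\<lambda>u::complex. u \<in> ball 0 1) (nhds 0)"
    by (intro eventually_nhds_in_open) auto
  then show "eventually (\<lambda>u. (\<lambda>n. cauchy_fps \<sigma> M $ n * u ^ n) sums cauchy_transform \<sigma> M u) (nhds 0)"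
    by eventually_elim (auto intro: cauchy_transform_sums[OF assms])
qed

lemma cauchy_transform_holomorphic:
  assumes "M \<in> M_plus"
  shows "cauchy_transform \<sigma> M holomorphic_on ball 0 1"
  by (rule power_series_holomorphic[of 0 1 "fps_nth (cauchy_fps \<sigma> M)"])
    (auto intro: cauchy_transform_sums[OF assms])

text \<open>The sign is that of the real part of \<open>(1 + u) * cnj (1 - u)\<close>, which is \<open>1 - (norm u)\<^sup>2\<close>.\<close>
lemma Re_circle_kernel_pos:
  assumes "norm u < 1"
  shows "Re ((1 + u) / (1 - u)) > 0"
proof -
  have "(1 + u) * cnj (1 - u) = (1 - of_real ((norm u)\<^sup>2)) + (u - cnj u)"
    using complex_norm_square[of u] by (simp add: algebra_simps)
  then have "Re ((1 + u) * cnj (1 - u)) = 1 - (norm u)\<^sup>2" by (simp add: complex_eq_iff)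
  moreover have "(norm u)\<^sup>2 < 1" using assms by (simp add: power_less_one_iff)
  ultimately show ?thesis
    using assms by (subst Re_complex_div_gt_0) simp
qed

text \<open>Here it matters that \<open>M_plus\<close> excludes the zero measure: the integral of a
  strictly positive function vanishes only if the total mass does.\<close>
lemma Re_cauchy_transform_pos:
  assumes M: "M \<in> M_plus" and z: "norm z < 1"
  shows "Re (cauchy_transform \<sigma> M z) > 0"
proof -
  interpret finite_measure M by (rule M_plus_D(1)[OF M])
  define k where "k w = (1 + cnj w * z) / (1 - cnj w * z)" for w
  have u: "norm (cnj w * z) < 1" if "w \<in> circle" for w
    using that z by (simp add: norm_mult)
  have "1 - cnj w * z \<noteq> 0" if "w \<in> circle" for w
    using u[OF that] by auto
  then have cont: "continuous_on circle k"
    unfolding k_def by (auto intro!: continuous_intros)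
  have pos: "Re (k w) > 0" if "w \<in> circle" for w
    unfolding k_def by (rule Re_circle_kernel_pos[OF u[OF that]])
  have "Re (cauchy_transform \<sigma> M z) = (\<integral>w. Re (k w) \<partial>M)"
    using integral_Re[OF integrable_continuous_on_circle[OF M cont]]
    by (simp add: cauchy_transform_def k_def[symmetric])
  also have "\<dots> > 0"
  proof -
    have int: "integrable M (\<lambda>w. Re (k w))"
      using cont by (intro integrable_continuous_on_circle[OF M] continuous_intros)
    have ae: "AE w in M. 0 < Re (k w)" using pos M_plus_D(3)[OF M] by auto
    then have ae_le: "AE w in M. 0 \<le> Re (k w)" by (auto elim: eventually_mono)
    have "(\<integral>w. Re (k w) \<partial>M) \<noteq> 0"
    proof
      assume "(\<integral>w. Re (k w) \<partial>M) = 0"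
      then have "AE w in M. Re (k w) = 0"
        using integral_nonneg_eq_0_iff_AE[OF int] ae_le by blast
      with ae have "AE w in M. False" by eventually_elim simp
      then have "emeasure M (space M) = 0" using AE_iff_measurable[of "space M" M "\<lambda>_. False"] by simp
      then show False using mass_pos[OF M] by (simp add: measure_def)
    qed
    moreover have "(\<integral>w. Re (k w) \<partial>M) \<ge> 0"
      by (rule integral_nonneg_AE[OF ae_le])
    ultimately show ?thesis by simp
  qed
  finally show ?thesis .
qed

lemma inverse_pair_imp_cauchy_fps_mult:
  assumes "M \<in> M_plus" "N \<in> M_plus" and pair: "inverse_pair (M, c) (N, d)"
  shows "cauchy_fps c M * cauchy_fps d N = 1"
proof -
  let ?h = "\<lambda>z. cauchy_transform c M z * cauchy_transform d N z"
  have h: "?h has_fps_expansion cauchy_fps c M * cauchy_fps d N"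
    using assms by (intro has_fps_expansion_mult has_fps_expansion_cauchy_transform)
  have "eventually (\<lambda>z::complex. z \<in> ball 0 1) (nhds 0)"
    by (intro eventually_nhds_in_open) auto
  then have "eventually (\<lambda>z. ?h z = 1) (nhds 0)"
    by eventually_elim (use pair in \<open>auto simp: inverse_pair_def\<close>)
  then have "?h has_fps_expansion 1"
    by (subst has_fps_expansion_cong[of ?h "\<lambda>_. 1" 1 1]) auto
  then show ?thesis using fps_expansion_unique_complex[OF h] by simp
qed

section \<open>Moments determine the weak topology\<close>

text \<open>Real trigonometric polynomials. The rules constrain the functions on the circle only: the product
  formula behind \<open>trig_poly_mult_monomials\<close> uses \<open>w * cnj w = 1\<close> and fails elsewhere. Monomials are
  written in \<open>cnj w\<close> because these are the functions integrated in \<open>moment\<close>.\<close>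
inductive trig_poly :: "(complex \<Rightarrow> real) \<Rightarrow> bool" where
  monomial: "(\<And>w. w \<in> circle \<Longrightarrow> f w = Re (a * cnj w ^ n)) \<Longrightarrow> trig_poly f"
| add: "trig_poly f \<Longrightarrow> trig_poly g \<Longrightarrow> (\<And>w. w \<in> circle \<Longrightarrow> h w = f w + g w) \<Longrightarrow> trig_poly h"

lemma trig_poly_continuous:
  "trig_poly f \<Longrightarrow> continuous_on circle f"
proof (induction rule: trig_poly.induct)
  case (monomial f a n)
  have "continuous_on circle (\<lambda>w. Re (a * cnj w ^ n))" by (intro continuous_intros)
  then show ?case by (rule continuous_on_eq) (simp only: monomial)
next
  case (add f g h)
  then have "continuous_on circle (\<lambda>w. f w + g w)" by (intro continuous_intros)
  then show ?case by (rule continuous_on_eq) (simp only: add)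
qed

text \<open>From \<open>Re x * Re y = Re (x * y) / 2 + Re (cnj x * y) / 2\<close>. On the circle, the conjugate of
  \<open>cnj w ^ m\<close> cancels \<open>m\<close> of the factors of \<open>cnj w ^ n\<close>; the assumption \<open>m \<le> n\<close> keeps the
  remaining exponent non-negative.\<close>
lemma trig_poly_mult_monomials:
  assumes "m \<le> n" "\<And>w. w \<in> circle \<Longrightarrow> h w = Re (a * cnj w ^ m) * Re (b * cnj w ^ n)"
  shows "trig_poly h"
proof (rule trig_poly.add)
  show "trig_poly (\<lambda>w. Re (a * b / 2 * cnj w ^ (m + n)))"
    "trig_poly (\<lambda>w. Re (cnj a * b / 2 * cnj w ^ (n - m)))"
    by (rule trig_poly.monomial, rule refl)+
  fix w :: complex assume w: "w \<in> circle"
  have "w * cnj w = 1" using w complex_norm_square[of w] by simp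
  then have "cnj (cnj w ^ m) * cnj w ^ m = 1"
    by (simp flip: power_mult_distrib)
  moreover have "cnj w ^ n = cnj w ^ m * cnj w ^ (n - m)"
    using \<open>m \<le> n\<close> by (simp flip: power_add)
  ultimately have *: "cnj (cnj w ^ m) * cnj w ^ n = cnj w ^ (n - m)"
    by (metis mult.assoc mult_1)
  have "Re x * Re y = Re (x * y / 2) + Re (cnj x * y / 2)" for x y :: complex
    by (simp add: field_simps)
  from this[of "a * cnj w ^ m" "b * cnj w ^ n"] assms(2)[OF w]
  have "h w = Re (a * cnj w ^ m * (b * cnj w ^ n) / 2) + Re (cnj (a * cnj w ^ m) * (b * cnj w ^ n) / 2)"
    by simp
  also have "a * cnj w ^ m * (b * cnj w ^ n) / 2 = a * b / 2 * cnj w ^ (m + n)"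
    by (simp add: power_add mult_ac)
  also have "cnj (a * cnj w ^ m) * (b * cnj w ^ n) / 2 = cnj a * b / 2 * cnj w ^ (n - m)"
    by (simp only: complex_cnj_mult *[symmetric] times_divide_eq_left times_divide_eq_right mult_ac)
  finally show "h w = Re (a * b / 2 * cnj w ^ (m + n)) + Re (cnj a * b / 2 * cnj w ^ (n - m))" .
qed

text \<open>By bilinearity this reduces to products of monomials; each induction peels the summands
  off one factor.\<close>
lemma trig_poly_mult:
  assumes "trig_poly f" "trig_poly g"
  shows "trig_poly (\<lambda>w. f w * g w)"
proof -
  have mono: "trig_poly (\<lambda>w. f w * g w)"
    if f: "\<And>w. w \<in> circle \<Longrightarrow> f w = Re (a * cnj w ^ m)" and g: "trig_poly g" for f g a m
    using g
  proof (induction rule: trig_poly.induct)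
    case (monomial g b n)
    show ?case
    proof (cases "m \<le> n")
      case True
      then show ?thesis
        by (rule trig_poly_mult_monomials[of m n _ a b]) (simp add: f monomial)
    next
      case False
      then have "n \<le> m" by simp
      then show ?thesis
        by (rule trig_poly_mult_monomials[of n m _ b a]) (simp add: f monomial mult.commute)
    qed
  next
    case (add g1 g2 h)
    show ?case
      by (rule trig_poly.add[OF add.IH]) (simp add: add.hyps algebra_simps)
  qed
  show ?thesis using assms(1)
  proof (induction rule: trig_poly.induct)
    case (monomial f a n)
    then show ?case using mono[OF _ assms(2)] by blast
  next
    case (add f1 f2 h)
    show ?case
      by (rule trig_poly.add[OF add.IH]) (simp add: add.hyps algebra_simps)
  qed
qed

text \<open>Stone--Weierstrass: the coordinates \<open>Re\<close> and \<open>Im\<close> are trigonometric polynomials, so points are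
  separated.\<close>
lemma trig_poly_dense:
  assumes "continuous_on circle f" "e > 0"
  obtains g where "trig_poly g" "\<And>w. w \<in> circle \<Longrightarrow> \<bar>f w - g w\<bar> < e"
proof -
  interpret function_ring_on "Collect trig_poly" "circle :: complex set"
  proof
    show "(\<lambda>x. f x + g x) \<in> Collect trig_poly"
      if "f \<in> Collect trig_poly" "g \<in> Collect trig_poly" for f g
      using that by (auto intro: trig_poly.add)
    show "(\<lambda>_. c) \<in> Collect trig_poly" for c
      by (auto intro!: trig_poly.monomial[of _ "of_real c" 0])
    fix x y :: complex assume "x \<noteq> y"
    moreover have "trig_poly Re" by (rule trig_poly.monomial[of _ 1 1]) simp
    moreover have "trig_poly Im" by (rule trig_poly.monomial[of _ \<i> 1]) simp
    ultimately show "\<exists>f\<in>Collect trig_poly. f x \<noteq> f y"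
      by (auto simp: complex_eq_iff)
  qed (auto intro: trig_poly_continuous trig_poly_mult)
  show ?thesis
    using Stone_Weierstrass_basic[OF assms] that by blast
qed

lemma trig_poly_integral_tendsto:
  assumes "trig_poly g"
    and N: "eventually (\<lambda>x. N x \<in> M_plus) F" and M: "M \<in> M_plus"
    and lim: "\<And>n. ((\<lambda>x. moment (N x) n) \<longlongrightarrow> moment M n) F"
  shows "((\<lambda>x. \<integral>w. g w \<partial>N x) \<longlongrightarrow> (\<integral>w. g w \<partial>M)) F"
  using assms(1)
proof (induction rule: trig_poly.induct)
  case (monomial f a n)
  have *: "(\<integral>w. f w \<partial>K) = Re (a * moment K n)" if K: "K \<in> M_plus" for K
  proof -
    have "(\<integral>w. f w \<partial>K) = (\<integral>w. Re (a * cnj w ^ n) \<partial>K)"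
      using monomial M_plus_D(3)[OF K] by (intro Bochner_Integration.integral_cong) auto
    also have "\<dots> = Re (\<integral>w. a * cnj w ^ n \<partial>K)"
      by (intro integral_Re integrable_continuous_on_circle[OF K] continuous_intros)
    finally show ?thesis by (simp add: moment_def)
  qed
  have "((\<lambda>x. Re (a * moment (N x) n)) \<longlongrightarrow> Re (a * moment M n)) F"
    by (intro tendsto_intros lim)
  moreover have "eventually (\<lambda>x. (\<integral>w. f w \<partial>N x) = Re (a * moment (N x) n)) F"
    using N by eventually_elim (rule *)
  ultimately show ?case using *[OF M] by (simp add: tendsto_cong)
next
  case (add f g h)
  have *: "(\<integral>w. h w \<partial>K) = (\<integral>w. f w \<partial>K) + (\<integral>w. g w \<partial>K)" if K: "K \<in> M_plus" for K
  proof -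
    have "(\<integral>w. h w \<partial>K) = (\<integral>w. f w + g w \<partial>K)"
      using add M_plus_D(3)[OF K] by (intro Bochner_Integration.integral_cong) auto
    also have "\<dots> = (\<integral>w. f w \<partial>K) + (\<integral>w. g w \<partial>K)"
      using add.hyps
      by (intro Bochner_Integration.integral_add integrable_continuous_on_circle[OF K]
          trig_poly_continuous)
    finally show ?thesis .
  qed
  have "((\<lambda>x. (\<integral>w. f w \<partial>N x) + (\<integral>w. g w \<partial>N x)) \<longlongrightarrow> (\<integral>w. f w \<partial>M) + (\<integral>w. g w \<partial>M)) F"
    by (intro tendsto_intros add.IH)
  moreover have "eventually (\<lambda>x. (\<integral>w. h w \<partial>N x) = (\<integral>w. f w \<partial>N x) + (\<integral>w. g w \<partial>N x)) F"
    using N by eventually_elim (rule *)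
  ultimately show ?case using *[OF M] by (simp add: tendsto_cong)
qed

lemma integral_diff_le_uniform_dist:
  assumes K: "K \<in> M_plus" and f: "continuous_on circle f" and g: "continuous_on circle g"
    and close: "\<And>w. w \<in> circle \<Longrightarrow> \<bar>f w - g w\<bar> \<le> (e::real)"
  shows "\<bar>(\<integral>w. f w \<partial>K) - (\<integral>w. g w \<partial>K)\<bar> \<le> e * measure K (space K)"
proof -
  interpret finite_measure K by (rule M_plus_D(1)[OF K])
  note int = integrable_continuous_on_circle[OF K]
  have "\<bar>(\<integral>w. f w \<partial>K) - (\<integral>w. g w \<partial>K)\<bar> = \<bar>\<integral>w. f w - g w \<partial>K\<bar>"
    using int[OF f] int[OF g] by simp
  also have "\<dots> \<le> (\<integral>w. \<bar>f w - g w\<bar> \<partial>K)"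
    by (rule integral_abs_bound)
  also have "\<dots> \<le> (\<integral>w. e \<partial>K)"
    using int f g close M_plus_D(3)[OF K]
    by (intro integral_mono) (auto intro!: int continuous_intros)
  finally show ?thesis by (simp add: mult.commute)
qed

text \<open>The approximation of \<open>f\<close> by a trigonometric polynomial costs at most the uniform error times the
  total mass. The masses are eventually bounded because the mass is the moment of order \<open>0\<close>.
  An arbitrary filter is allowed so that the lemma yields both uniqueness (constant \<open>N\<close>) and
  continuity in the weak topology, whose metrizability then need not be established.\<close>
lemma moments_tendsto_imp_integral_tendsto:
  fixes f :: "complex \<Rightarrow> real"
  assumes N: "eventually (\<lambda>x. N x \<in> M_plus) F" and M: "M \<in> M_plus"
    and lim: "\<And>n. ((\<lambda>x. moment (N x) n) \<longlongrightarrow> moment M n) F"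
    and f: "continuous_on circle f"
  shows "((\<lambda>x. \<integral>w. f w \<partial>N x) \<longlongrightarrow> (\<integral>w. f w \<partial>M)) F"
proof (rule tendstoI)
  fix e :: real assume "e > 0"
  \<comment> \<open>any bound above the mass of \<open>M\<close> eventually bounds the mass of \<open>N x\<close>\<close>
  define K where "K = measure M (space M) + 1"
  have "K > 0" using mass_pos[OF M] by (simp add: K_def)
  define d where "d = e / (3 * K)"
  have "d > 0" and dK: "d * K = e / 3" using \<open>e > 0\<close> \<open>K > 0\<close> by (auto simp: d_def)
  obtain g where g: "trig_poly g" and fg: "\<And>w. w \<in> circle \<Longrightarrow> \<bar>f w - g w\<bar> < d"
    using trig_poly_dense[OF f \<open>d > 0\<close>] by blast
  have close: "\<bar>(\<integral>w. f w \<partial>L) - (\<integral>w. g w \<partial>L)\<bar> \<le> e / 3"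
    if L: "L \<in> M_plus" "measure L (space L) < K" for L
  proof -
    have "\<bar>(\<integral>w. f w \<partial>L) - (\<integral>w. g w \<partial>L)\<bar> \<le> d * measure L (space L)"
      using fg by (intro integral_diff_le_uniform_dist L f trig_poly_continuous[OF g] less_imp_le)
    also have "\<dots> \<le> d * K" using L \<open>d > 0\<close> by simp
    finally show ?thesis using dK by simp
  qed
  have "((\<lambda>x. Re (moment (N x) 0)) \<longlongrightarrow> Re (moment M 0)) F" by (intro tendsto_intros lim)
  then have "eventually (\<lambda>x. Re (moment (N x) 0) < K) F"
    by (rule order_tendstoD) (simp add: K_def moment_0)
  then have "eventually (\<lambda>x. measure (N x) (space (N x)) < K) F" by (simp add: moment_0)
  moreover have "eventually (\<lambda>x. dist (\<integral>w. g w \<partial>N x) (\<integral>w. g w \<partial>M) < e / 3) F"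
    using \<open>e > 0\<close> by (intro tendstoD[OF trig_poly_integral_tendsto[OF g N M lim]]) auto
  ultimately show "eventually (\<lambda>x. dist (\<integral>w. f w \<partial>N x) (\<integral>w. f w \<partial>M) < e) F"
    using N
  proof eventually_elim
    case (elim x)
    have "measure M (space M) < K" by (simp add: K_def)
    with close[of "N x"] close[OF M] elim
    have "\<bar>(\<integral>w. f w \<partial>N x) - (\<integral>w. g w \<partial>N x)\<bar> \<le> e / 3"
      "\<bar>(\<integral>w. f w \<partial>M) - (\<integral>w. g w \<partial>M)\<bar> \<le> e / 3"
      "\<bar>(\<integral>w. g w \<partial>N x) - (\<integral>w. g w \<partial>M)\<bar> < e / 3"
      by (auto simp: dist_real_def)
    then show ?case unfolding dist_real_def by argo
  qed
qed

text \<open>The integrands are continuous and decrease to the indicator function of \<open>C\<close>. The set \<open>C\<close> must be non-empty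
  since \<open>infdist w {} = 0\<close> by convention.\<close>
lemma measure_closed_tendsto:
  assumes K: "K \<in> M_plus" and C: "closed C" "C \<noteq> {}"
  shows "(\<lambda>k. \<integral>w. max 0 (1 - real k * infdist w C) \<partial>K) \<longlonglongrightarrow> measure K (C \<inter> circle)"
proof -
  interpret finite_measure K by (rule M_plus_D(1)[OF K])
  have meas: "C \<inter> circle \<in> sets K"
    using C by (simp add: M_plus_D(2)[OF K] sets_restrict_space_iff)
  have cont: "continuous_on circle (\<lambda>w. max 0 (1 - real k * infdist w C))" for k
    by (intro continuous_intros)
  have "(\<lambda>k. \<integral>w. max 0 (1 - real k * infdist w C) \<partial>K) \<longlonglongrightarrow> (\<integral>w. indicator (C \<inter> circle) w \<partial>K)"
  proof (rule integral_dominated_convergence[where w = "\<lambda>_. 1"])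
    show "(\<lambda>w. indicator (C \<inter> circle) w) \<in> borel_measurable K" using meas by simp
    show "(\<lambda>w. max 0 (1 - real k * infdist w C)) \<in> borel_measurable K" for k
      by (rule borel_measurable_continuous_on_circle[OF K cont])
    show "integrable K (\<lambda>_. 1::real)" by simp
    show "AE w in K. norm (max 0 (1 - real k * infdist w C)) \<le> 1" for k
      using infdist_nonneg[of _ C] by (intro AE_I2) auto
    show "AE w in K. (\<lambda>k. max 0 (1 - real k * infdist w C)) \<longlonglongrightarrow> indicator (C \<inter> circle) w"
    proof (rule AE_I2)
      fix w assume "w \<in> space K"
      then have w: "w \<in> circle" by (simp add: M_plus_D(3)[OF K])
      show "(\<lambda>k. max 0 (1 - real k * infdist w C)) \<longlonglongrightarrow> indicator (C \<inter> circle) w"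
      proof (cases "w \<in> C")
        case True
        then show ?thesis using w by simp
      next
        case False
        then have d: "infdist w C > 0"
          using C in_closed_iff_infdist_zero infdist_nonneg[of w C] by (metis less_eq_real_def)
        obtain k0 where k0: "1 < real k0 * infdist w C"
          using reals_Archimedean3[OF d] by blast
        have "eventually (\<lambda>k. max 0 (1 - real k * infdist w C) = 0) sequentially"
          using eventually_ge_at_top[of k0]
        proof eventually_elim
          case (elim k)
          then have "real k0 * infdist w C \<le> real k * infdist w C"
            using d by (intro mult_right_mono) auto
          then show ?case using k0 by simp
        qed
        then show ?thesis using False by (simp add: tendsto_eventually)
      qed
    qed
  qed
  then show ?thesis using meas M_plus_D(3)[OF K] by (simp add: Int_absorb2)
qed

text \<open>The integrals determine the values on closed sets, which form a generator of the Borel sets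
  that is stable under intersection. The measures are pushed forward to the plane, so that the generator consists
  of all closed subsets of the plane.\<close>
lemma M_plus_eqI_integrals:
  assumes M: "M \<in> M_plus" and N: "N \<in> M_plus"
    and eq: "\<And>f :: complex \<Rightarrow> real. continuous_on circle f \<Longrightarrow> (\<integral>w. f w \<partial>M) = (\<integral>w. f w \<partial>N)"
  shows "M = N"
proof -
  interpret M: finite_measure M by (rule M_plus_D(1)[OF M])
  interpret N: finite_measure N by (rule M_plus_D(1)[OF N])
  have id: "(\<lambda>w. w) \<in> borel_measurable K" if "K \<in> M_plus" for K
    by (rule borel_measurable_continuous_on_circle[OF that continuous_on_id])
  note emeas = emeasure_distr[OF id]
  have closed: "emeasure M (C \<inter> circle) = emeasure N (C \<inter> circle)" if "closed C" for C
  proof (cases "C = {}")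
    case False
    have "(\<lambda>k. \<integral>w. max 0 (1 - real k * infdist w C) \<partial>M)
        = (\<lambda>k. \<integral>w. max 0 (1 - real k * infdist w C) \<partial>N)"
      by (intro ext eq continuous_intros)
    then have "measure M (C \<inter> circle) = measure N (C \<inter> circle)"
      using measure_closed_tendsto[OF M that False] measure_closed_tendsto[OF N that False]
      by (simp add: LIMSEQ_unique)
    then show ?thesis by (simp add: M.emeasure_eq_measure N.emeasure_eq_measure)
  qed simp
  have distr: "distr M borel (\<lambda>w. w) = distr N borel (\<lambda>w. w)"
  proof (rule measure_eqI_generator_eq[where E = "Collect closed" and \<Omega> = UNIV and A = "\<lambda>_. UNIV"])
    show "Int_stable (Collect closed :: complex set set)" by (auto simp: Int_stable_def)
    show "emeasure (distr M borel (\<lambda>w. w)) C = emeasure (distr N borel (\<lambda>w. w)) C"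
      if "C \<in> Collect closed" for C
      using that closed by (simp add: emeas M N M_plus_D(3)[OF M] M_plus_D(3)[OF N])
    show "emeasure (distr M borel (\<lambda>w. w)) UNIV \<noteq> \<infinity>" for i :: nat
      by (simp add: emeas M)
  qed (auto simp: borel_eq_closed)
  show ?thesis
  proof (rule measure_eqI)
    show "sets M = sets N" using M_plus_D(2)[OF M] M_plus_D(2)[OF N] by simp
    fix A assume "A \<in> sets M"
    then have A: "A \<in> sets borel" "A \<subseteq> circle"
      using M_plus_D(2)[OF M] by (auto simp: sets_restrict_space_iff)
    then have "emeasure M A = emeasure (distr M borel (\<lambda>w. w)) A"
      by (simp add: emeas M M_plus_D(3)[OF M] Int_absorb2)
    also have "\<dots> = emeasure N A"
      using A by (simp add: distr emeas N M_plus_D(3)[OF N] Int_absorb2)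
    finally show "emeasure M A = emeasure N A" .
  qed
qed

lemma M_plus_eqI_moments:
  assumes M: "M \<in> M_plus" and N: "N \<in> M_plus" and eq: "\<And>n. moment M n = moment N n"
  shows "M = N"
proof (rule M_plus_eqI_integrals[OF M N])
  fix f :: "complex \<Rightarrow> real" assume "continuous_on circle f"
  then have "((\<lambda>_. \<integral>w. f w \<partial>M) \<longlongrightarrow> (\<integral>w. f w \<partial>N)) sequentially"
    using eq by (intro moments_tendsto_imp_integral_tendsto N) (auto simp: M)
  then show "(\<integral>w. f w \<partial>M) = (\<integral>w. f w \<partial>N)" by (simp add: LIMSEQ_const_iff)
qed

section \<open>Herglotz representation\<close>

text \<open>Cauchy's formula for the \<open>n\<close>-th derivative at the origin, with the circle of radius \<open>r\<close> parametrised by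
  \<open>t \<mapsto> r * cis (2 * pi * t)\<close>. On it \<open>cnj (cis (2 * pi * t))\<close> is the inverse of \<open>cis (2 * pi * t)\<close>.\<close>
lemma taylor_coeff_circle_integral:
  assumes f: "f holomorphic_on ball 0 1" and r: "0 < r" "r < 1"
  shows "((\<lambda>t. f (of_real r * cis (2 * pi * t)) * cnj (cis (2 * pi * t)) ^ n) has_integral
          of_real r ^ n * ((deriv ^^ n) f 0 / fact n)) {0..1}"
proof -
  have sub: "cball 0 r \<subseteq> ball (0::complex) 1" using r by auto
  let ?a = "(deriv ^^ n) f 0"
  have "((\<lambda>u. f u / (u - 0) ^ Suc n) has_contour_integral (2 * pi * \<i>) / fact n * ?a) (circlepath 0 r)"
    using r f sub
    by (intro Cauchy_has_contour_integral_higher_derivative_circlepath holomorphic_on_imp_continuous_on)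
      (auto intro: holomorphic_on_subset)
  then have "((\<lambda>t. f (circlepath 0 r t) / (circlepath 0 r t) ^ Suc n
      * vector_derivative (circlepath 0 r) (at t within {0..1})) has_integral
      (2 * pi * \<i>) / fact n * ?a) {0..1}"
    by (simp add: has_contour_integral_def)
  then have integral: "((\<lambda>t. of_real r ^ n / (2 * pi * \<i>) * (f (circlepath 0 r t) / (circlepath 0 r t) ^ Suc n
      * vector_derivative (circlepath 0 r) (at t within {0..1}))) has_integral
      of_real r ^ n / (2 * pi * \<i>) * ((2 * pi * \<i>) / fact n * ?a)) {0..1}"
    by (rule has_integral_mult_right)
  have coeff: "of_real r ^ n / (2 * pi * \<i>) * ((2 * pi * \<i>) / fact n * ?a)
      = of_real r ^ n * (?a / fact n)"
  proof -
    have cancel: "x / y * (y / z * b) = x * (b / z)" if "y \<noteq> 0" for x y z b :: complex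
      using that by simp
    show ?thesis by (rule cancel) simp
  qed
  have integrand: "of_real r ^ n / (2 * pi * \<i>) * (f (circlepath 0 r t) / (circlepath 0 r t) ^ Suc n
      * vector_derivative (circlepath 0 r) (at t within {0..1}))
      = f (of_real r * cis (2 * pi * t)) * cnj (cis (2 * pi * t)) ^ n" if "t \<in> {0..1}" for t
  proof -
    define c where "c = cis (2 * pi * t)"
    have c: "circlepath 0 r t = of_real r * c"
      by (simp add: circlepath c_def cis_conv_exp mult_ac)
    have c': "vector_derivative (circlepath 0 r) (at t within {0..1}) = 2 * pi * \<i> * r * c"
      using vector_derivative_circlepath01[of t 0 r] that by (simp add: c_def cis_conv_exp mult_ac)
    have inv: "cnj c = inverse c" and "c \<noteq> 0" by (simp_all add: c_def cis_cnj)
    show ?thesis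
      unfolding c c' c_def[symmetric] inv using r \<open>c \<noteq> 0\<close>
      by (simp add: field_simps)
  qed
  show ?thesis using has_integral_eq[OF integrand integral] unfolding coeff .
qed

text \<open>The mean value property of \<open>u \<mapsto> f u * u ^ n\<close>, i.e. the previous lemma at order \<open>0\<close>: the
  Fourier coefficients of negative order vanish.\<close>
lemma negative_coeff_circle_integral:
  assumes f: "f holomorphic_on ball 0 1" and r: "0 < r" "r < 1"
  shows "((\<lambda>t. f (of_real r * cis (2 * pi * t)) * cis (2 * pi * t) ^ n) has_integral
          (if n = 0 then f 0 else 0)) {0..1}"
proof -
  have "((\<lambda>t. f (of_real r * cis (2 * pi * t)) * (of_real r * cis (2 * pi * t)) ^ n) has_integral
      (f 0 * 0 ^ n)) {0..1}"
  proof -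
    have "(\<lambda>u. f u * u ^ n) holomorphic_on ball 0 1" by (intro holomorphic_intros f)
    from taylor_coeff_circle_integral[OF this r, of 0] show ?thesis by simp
  qed
  then have "((\<lambda>t. inverse (of_real r ^ n) *
      (f (of_real r * cis (2 * pi * t)) * (of_real r * cis (2 * pi * t)) ^ n)) has_integral
      inverse (of_real r ^ n) * (f 0 * 0 ^ n)) {0..1}"
    by (rule has_integral_mult_right)
  moreover have "inverse (of_real r ^ n) * (f (of_real r * cis (2 * pi * t)) * (of_real r * cis (2 * pi * t)) ^ n)
    = f (of_real r * cis (2 * pi * t)) * cis (2 * pi * t) ^ n" for t
    using r by (simp add: power_mult_distrib)
  moreover have "inverse (of_real r ^ n) * (f 0 * 0 ^ n) = (if n = 0 then f 0 else 0)" by simp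
  ultimately show ?thesis by simp
qed

text \<open>Write \<open>Re f = (f + cnj f) / 2\<close>. For \<open>n > 0\<close> only \<open>f\<close> contributes, as the conjugate part is a
  coefficient of negative order; for \<open>n = 0\<close> the two parts combine to \<open>Re (f 0)\<close>.\<close>
lemma real_part_circle_integral:
  assumes f: "f holomorphic_on ball 0 1" and r: "0 < r" "r < 1"
  shows "((\<lambda>t. Re (f (of_real r * cis (2 * pi * t))) *\<^sub>R cnj (cis (2 * pi * t)) ^ n) has_integral
          (if n = 0 then of_real (Re (f 0)) else of_real r ^ n * ((deriv ^^ n) f 0 / fact n) / 2)) {0..1}"
proof -
  let ?F = "\<lambda>t. f (of_real r * cis (2 * pi * t))" and ?c = "\<lambda>t. cis (2 * pi * t)"
  let ?a = "of_real r ^ n * ((deriv ^^ n) f 0 / fact n)"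
  have "((\<lambda>t. cnj (?F t * ?c t ^ n)) has_integral cnj (if n = 0 then f 0 else 0)) {0..1}"
    using has_integral_linear[OF negative_coeff_circle_integral[OF assms] bounded_linear_cnj]
    by (simp add: o_def)
  from has_integral_add[OF taylor_coeff_circle_integral[OF assms, of n] this]
  have "((\<lambda>t. (?F t * cnj (?c t) ^ n + cnj (?F t * ?c t ^ n)) / 2) has_integral
      (?a + cnj (if n = 0 then f 0 else 0)) / 2) {0..1}"
    by (rule has_integral_divide)
  moreover have "(?F t * cnj (?c t) ^ n + cnj (?F t * ?c t ^ n)) / 2 = Re (?F t) *\<^sub>R cnj (?c t) ^ n" for t
  proof -
    have "(?F t * cnj (?c t) ^ n + cnj (?F t * ?c t ^ n)) / 2 = (?F t + cnj (?F t)) / 2 * cnj (?c t) ^ n"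
      by (simp add: field_simps)
    also have "(?F t + cnj (?F t)) / 2 = of_real (Re (?F t))" by (simp add: complex_add_cnj)
    finally show ?thesis by (simp add: scaleR_conv_of_real)
  qed
  moreover have "(?a + cnj (if n = 0 then f 0 else 0)) / 2
      = (if n = 0 then of_real (Re (f 0)) else ?a / 2)"
    by (simp add: complex_add_cnj)
  ultimately show ?thesis by (simp only:)
qed

lemma continuous_on_dilation:
  assumes f: "f holomorphic_on ball 0 1" and r: "0 < r" "r < 1"
  shows "continuous_on UNIV (\<lambda>t. f (of_real r * cis (2 * pi * t)))"
  by (rule continuous_on_compose2[OF holomorphic_on_imp_continuous_on[OF f]])
    (use r in \<open>auto intro!: continuous_intros simp: norm_mult\<close>)

text \<open>The boundary values of \<open>Re f\<close> on the circle of radius \<open>r\<close>, as a measure on the parameter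
  interval. By the mean value property, dividing by \<open>Re (f 0)\<close> makes it a probability measure. It is a
  measure on the real line since Helly's theorem is about distribution functions.\<close>
definition dilated_density :: "(complex \<Rightarrow> complex) \<Rightarrow> real \<Rightarrow> real measure" where
  "dilated_density f r = density lborel
     (\<lambda>t. indicator {0..1} t * (Re (f (of_real r * cis (2 * pi * t))) / Re (f 0)))"

lemma dilated_density_integral:
  fixes g :: "real \<Rightarrow> complex"
  assumes f: "f holomorphic_on ball 0 1" "\<And>z. z \<in> ball 0 1 \<Longrightarrow> Re (f z) > 0" and r: "0 < r" "r < 1"
    and g: "continuous_on UNIV g"
    and int: "((\<lambda>t. Re (f (of_real r * cis (2 * pi * t))) *\<^sub>R g t) has_integral I) {0..1}"
  shows "integrable (dilated_density f r) g" 
    "(\<integral>t. g t \<partial>dilated_density f r) = I / of_real (Re (f 0))"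
proof -
  let ?h = "\<lambda>t. Re (f (of_real r * cis (2 * pi * t)))"
  have h: "continuous_on UNIV ?h" by (intro continuous_intros continuous_on_dilation f r)
  have [measurable]: "?h \<in> borel_measurable borel" "g \<in> borel_measurable borel"
    by (intro borel_measurable_continuous_onI h g)+
  have pos: "0 \<le> indicator {0..1} t * (?h t / Re (f 0))" for t :: real
    using f(2)[of 0] f(2)[of "of_real r * cis (2 * pi * t)"] r by (simp add: norm_mult)
  let ?k = "\<lambda>t. ?h t *\<^sub>R g t"
  have k: "set_integrable lborel {0..1} ?k"
    by (rule borel_integrable_atLeastAtMost') (intro continuous_intros continuous_on_subset[OF h] continuous_on_subset[OF g], auto)
  have eq: "(indicator {0..1} t * (?h t / Re (f 0))) *\<^sub>R g t
      = inverse (Re (f 0)) *\<^sub>R (indicator {0..1} t *\<^sub>R ?k t)" for t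
    by (simp add: divide_inverse)
  show "integrable (dilated_density f r) g"
    unfolding dilated_density_def
  proof (rule integrable_density[THEN iffD2, rotated -1])
    show "integrable lborel (\<lambda>t. (indicator {0..1} t * (?h t / Re (f 0))) *\<^sub>R g t)"
      unfolding eq using k[unfolded set_integrable_def] by (rule integrable_scaleR_right)
  qed (use pos in auto)
  have "(\<integral>t. g t \<partial>dilated_density f r) = inverse (Re (f 0)) *\<^sub>R (LINT t:{0..1}|lborel. ?k t)"
  proof -
    have "(\<integral>t. g t \<partial>dilated_density f r)
        = (\<integral>t. (indicator {0..1} t * (?h t / Re (f 0))) *\<^sub>R g t \<partial>lborel)"
      unfolding dilated_density_def by (rule integral_density) (use pos in auto)
    then show ?thesis by (simp only: eq set_lebesgue_integral_def integral_scaleR_right)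
  qed
  also have "(LINT t:{0..1}|lborel. ?k t) = I"
    using set_borel_integral_eq_integral(2)[OF k] int by (simp add: integral_unique)
  finally show "(\<integral>t. g t \<partial>dilated_density f r) = I / of_real (Re (f 0))"
    by (simp add: scaleR_conv_of_real divide_inverse mult.commute)
qed

lemma continuous_on_cis_pow: "continuous_on UNIV (\<lambda>t. cnj (cis (2 * pi * t)) ^ n)"
  by (intro continuous_intros)

lemma dilated_density_moment:
  assumes f: "f holomorphic_on ball 0 1" "\<And>z. z \<in> ball 0 1 \<Longrightarrow> Re (f z) > 0" and r: "0 < r" "r < 1"
  shows "(\<integral>t. cnj (cis (2 * pi * t)) ^ n \<partial>dilated_density f r) =
    (if n = 0 then 1 else of_real r ^ n * ((deriv ^^ n) f 0 / fact n) / 2 / of_real (Re (f 0)))"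
  using f(2)[of 0]
  by (subst dilated_density_integral(2)[OF f r continuous_on_cis_pow real_part_circle_integral[OF f(1) r]])
    auto

text \<open>The total mass is the moment of order \<open>0\<close>. All the mass lies in the fixed bounded interval, so
  the family over all \<open>r\<close> is tight.\<close>
lemma real_distribution_dilated_density:
  assumes f: "f holomorphic_on ball 0 1" "\<And>z. z \<in> ball 0 1 \<Longrightarrow> Re (f z) > 0" and r: "0 < r" "r < 1"
  shows "real_distribution (dilated_density f r)" "measure (dilated_density f r) {-1<..1} = 1"
proof -
  let ?D = "dilated_density f r"
  have sets: "sets ?D = sets borel" and space: "space ?D = UNIV"
    by (simp_all add: dilated_density_def)
  have *: "integrable ?D (\<lambda>t. 1 :: complex)" "(\<integral>t. (1 :: complex) \<partial>?D) = 1"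
    using dilated_density_integral(1)[OF f r continuous_on_cis_pow[of 0] real_part_circle_integral[OF f(1) r]]
      dilated_density_moment[OF f r, of 0] by simp_all
  then have fin: "emeasure ?D (space ?D) < \<infinity>" by (simp add: integrable_iff_bounded)
  then interpret finite_measure ?D by (intro finite_measureI) simp
  have "measure ?D (space ?D) = 1"
    using *(2) by (simp flip: of_real_def)
  then have "prob_space ?D" by (intro prob_spaceI) (simp add: emeasure_eq_measure)
  then show "real_distribution ?D"
    by (simp add: real_distribution_def real_distribution_axioms_def sets)
  have "emeasure ?D (- {-1<..1}) = 0"
  proof -
    have "continuous_on UNIV (\<lambda>t. Re (f (of_real r * cis (2 * pi * t))))"
      by (intro continuous_intros continuous_on_dilation f r)
    then have [measurable]: "(\<lambda>t. Re (f (of_real r * cis (2 * pi * t)))) \<in> borel_measurable borel"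
      by (rule borel_measurable_continuous_onI)
    let ?d = "\<lambda>t. indicator {0..1} t * (Re (f (of_real r * cis (2 * pi * t))) / Re (f 0))"
    have "emeasure ?D (- {-1<..1}) = (\<integral>\<^sup>+t. ennreal (?d t) * indicator (- {-1<..1}) t \<partial>lborel)"
      unfolding dilated_density_def by (rule emeasure_density) auto
    also have "(\<lambda>t. ennreal (?d t) * indicator (- {-1<..1}) t) = (\<lambda>_. 0)"
      by (auto simp: fun_eq_iff split: split_indicator)
    finally show ?thesis by simp
  qed
  then have "measure ?D (space ?D - {-1<..1}) = 0" by (simp add: measure_def space Compl_eq_Diff_UNIV)
  moreover have "measure ?D (space ?D - {-1<..1}) = measure ?D (space ?D) - measure ?D {-1<..1}"
    by (rule finite_measure_compl) (simp add: sets)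
  ultimately show "measure ?D {-1<..1} = 1" using \<open>measure ?D (space ?D) = 1\<close> by simp
qed

text \<open>A weak limit \<open>P\<close> of the dilated densities along radii tending to \<open>1\<close>, wrapped around the circle and scaled by
  \<open>Re (f 0)\<close>, has the moments prescribed by the Taylor coefficients of \<open>f\<close>. Hence its Cauchy
  transform has the same power series as \<open>f\<close>; the additive constant \<open>Im (f 0)\<close> is the part of
  \<open>f 0\<close> that a positive measure cannot produce.\<close>
theorem Herglotz_representation:
  assumes f: "f holomorphic_on ball 0 1" "\<And>z. z \<in> ball 0 1 \<Longrightarrow> Re (f z) > 0"
  obtains M where "M \<in> M_plus" "\<And>z. z \<in> ball 0 1 \<Longrightarrow> cauchy_transform (Im (f 0)) M z = f z"
proof -
  define m where "m = Re (f 0)"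
  have m: "m > 0" using f(2)[of 0] by (simp add: m_def)
  define a where "a n = (deriv ^^ n) f 0 / fact n" for n
  define r :: "nat \<Rightarrow> real" where "r k = 1 - inverse (real (Suc (Suc k)))" for k
  have r: "0 < r k" "r k < 1" for k by (auto simp: r_def field_simps)
  have r1: "r \<longlonglongrightarrow> 1"
    using LIMSEQ_inverse_real_of_nat_add_minus[of 1] LIMSEQ_Suc unfolding r_def by force
  define \<nu> where "\<nu> k = dilated_density f (r k)" for k
  have "tight \<nu>"
    unfolding tight_def \<nu>_def
    using real_distribution_dilated_density[OF f r]
    by (intro conjI allI impI exI[of _ "-1"] exI[of _ 1]) auto
  then obtain s P where s: "strict_mono (s :: nat \<Rightarrow> nat)" and P: "real_distribution P"
    and conv: "weak_conv_m (\<nu> \<circ> id \<circ> s) P"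
    using tight_imp_convergent_subsubsequence[OF _ strict_mono_id] by blast
  interpret P: real_distribution P by (rule P)
  have mom_\<nu>: "(\<integral>t. cnj (cis (2 * pi * t)) ^ n \<partial>\<nu> k)
      = (if n = 0 then 1 else of_real (r k) ^ n * a n / 2 / of_real m)" for k n
    unfolding \<nu>_def a_def m_def by (rule dilated_density_moment[OF f r])
  have momP: "(\<integral>t. cnj (cis (2 * pi * t)) ^ n \<partial>P) = (if n = 0 then 1 else a n / 2 / of_real m)" for n
  proof (rule LIMSEQ_unique)
    show "(\<lambda>k. \<integral>t. cnj (cis (2 * pi * t)) ^ n \<partial>\<nu> (s k)) \<longlonglongrightarrow> (\<integral>t. cnj (cis (2 * pi * t)) ^ n \<partial>P)"
      using weak_conv_imp_integral_bdd_continuous_conv[OF _ P conv,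
          of "\<lambda>t. cnj (cis (2 * pi * t)) ^ n" 1]
        real_distribution_dilated_density(1)[OF f r] continuous_on_cis_pow[of n]
      by (simp add: \<nu>_def norm_power continuous_on_eq_continuous_at)
    have "(\<lambda>k. of_real (r (s k)) ^ n * a n / 2 / of_real m) \<longlonglongrightarrow> of_real 1 ^ n * a n / 2 / of_real m"
      using m LIMSEQ_subseq_LIMSEQ[OF r1 s] by (intro tendsto_intros) (auto simp: o_def)
    then show "(\<lambda>k. \<integral>t. cnj (cis (2 * pi * t)) ^ n \<partial>\<nu> (s k))
        \<longlonglongrightarrow> (if n = 0 then 1 else a n / 2 / of_real m)"
      unfolding mom_\<nu> by (cases "n = 0") simp_all
  qed
  have cis_meas: "(\<lambda>t. cis (2 * pi * t)) \<in> measurable P borel_circle"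
  proof (rule measurable_restrict_space2)
    have "continuous_on UNIV (\<lambda>t. cis (2 * pi * t))" by (intro continuous_intros)
    then show "(\<lambda>t. cis (2 * pi * t)) \<in> borel_measurable P"
      using borel_measurable_continuous_onI by (simp add: measurable_cong_sets[OF P.events_eq_borel refl])
  qed auto
  define M where "M = density (distr P borel_circle (\<lambda>t. cis (2 * pi * t))) (\<lambda>_. ennreal m)"
  have setsM: "sets M = sets borel_circle" by (simp add: M_def)
  have int: "(\<integral>w. g w \<partial>M) = m *\<^sub>R (\<integral>t. g (cis (2 * pi * t)) \<partial>P)"
    if "continuous_on circle g" for g :: "complex \<Rightarrow> complex"
  proof -
    have g: "g \<in> borel_measurable borel_circle" by (rule borel_measurable_continuous_on_restrict[OF that])
    have "(\<integral>w. g w \<partial>M) = (\<integral>w. m *\<^sub>R g w \<partial>distr P borel_circle (\<lambda>t. cis (2 * pi * t)))"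
      unfolding M_def using g m by (subst integral_density) auto
    also have "\<dots> = (\<integral>t. m *\<^sub>R g (cis (2 * pi * t)) \<partial>P)"
      using g by (subst integral_distr[OF cis_meas]) auto
    finally show ?thesis by simp
  qed
  have mom: "moment M n = (if n = 0 then of_real m else a n / 2)" for n
    unfolding moment_def using m
    by (subst int) (auto intro!: continuous_intros simp: momP scaleR_conv_of_real)
  have M: "M \<in> M_plus"
  proof -
    have "emeasure M (space M) \<noteq> \<infinity>"
    proof -
      have "emeasure (distr P borel_circle (\<lambda>t. cis (2 * pi * t))) circle = 1"
      proof -
        have "(\<lambda>t. cis (2 * pi * t)) -` circle = UNIV" by auto
        then show ?thesis using P.emeasure_space_1
          by (subst emeasure_distr[OF cis_meas]) (auto simp: sets_restrict_space_iff)
      qed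
      moreover have "emeasure M (space M)
          = ennreal m * emeasure (distr P borel_circle (\<lambda>t. cis (2 * pi * t))) circle"
        unfolding M_def
        by (subst emeasure_density_const) (auto simp: space_restrict_space sets_restrict_space_iff)
      ultimately show ?thesis by simp
    qed
    then have "finite_measure M" by (rule finite_measureI)
    moreover have "M \<noteq> null_measure borel_circle"
    proof
      assume "M = null_measure borel_circle"
      then have "moment M 0 = 0" by (simp add: moment_def)
      then show False using mom[of 0] m by simp
    qed
    ultimately show ?thesis using setsM by (simp add: M_plus_def)
  qed
  have "measure M (space M) = m" using mom[of 0] by (simp add: moment_0)
  then have coeff: "cauchy_fps (Im (f 0)) M $ n = a n" for n
    using mom[of n] by (cases "n = 0") (simp_all add: cauchy_fps_def a_def m_def)
  have "cauchy_transform (Im (f 0)) M z = f z" if "z \<in> ball 0 1" for z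
    using cauchy_transform_sums[OF M, of z "Im (f 0)"] holomorphic_power_series[OF f(1) that] that
    unfolding coeff a_def by (auto dest: sums_unique2)
  with M show ?thesis using that by blast
qed

section \<open>The inversion map\<close>

lemma inverse_pair_sym: "inverse_pair p q \<longleftrightarrow> inverse_pair q p"
  by (cases p; cases q) (auto simp: inverse_pair_def mult.commute)

lemma inverse_pair_exists:
  assumes p: "p \<in> M_plus \<times> UNIV"
  shows "\<exists>q \<in> M_plus \<times> UNIV. inverse_pair p q"
proof -
  obtain l c where p_eq: "p = (l, c)" and l: "l \<in> M_plus" using p by auto
  let ?F = "cauchy_transform c l"
  have pos: "Re (?F z) > 0" if "z \<in> ball 0 1" for z
    using Re_cauchy_transform_pos[OF l] that by simp
  then have nz: "?F z \<noteq> 0" if "z \<in> ball 0 1" for z using that by force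
  have "(\<lambda>z. inverse (?F z)) holomorphic_on ball 0 1"
    using nz by (intro holomorphic_intros cauchy_transform_holomorphic[OF l]) auto
  moreover have "Re (inverse (?F z)) > 0" if "z \<in> ball 0 1" for z
    using pos[OF that] by (simp add: add_pos_nonneg)
  ultimately obtain m where m: "m \<in> M_plus"
    "\<And>z. z \<in> ball 0 1 \<Longrightarrow> cauchy_transform (Im (inverse (?F 0))) m z = inverse (?F z)"
    using Herglotz_representation[of "\<lambda>z. inverse (?F z)"] by blast
  then have "inverse_pair p (m, Im (inverse (?F 0)))"
    unfolding p_eq inverse_pair_def using nz by auto
  then show ?thesis using m(1) by blast
qed

lemma cauchy_fps_inject:
  assumes "M \<in> M_plus" "N \<in> M_plus" "cauchy_fps c M = cauchy_fps d N"
  shows "M = N" "c = d"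
proof -
  have 0: "Complex (measure M (space M)) c = Complex (measure N (space N)) d"
    using arg_cong[OF assms(3), of "\<lambda>A. A $ 0"] by (simp add: cauchy_fps_nth_0)
  then show "c = d" by simp
  show "M = N"
  proof (rule M_plus_eqI_moments[OF assms(1,2)])
    fix n
    show "moment M n = moment N n"
      using 0 arg_cong[OF assms(3), of "\<lambda>A. A $ n"]
      by (cases "n = 0") (simp_all add: cauchy_fps_nth moment_0)
  qed
qed

lemma inverse_pair_unique:
  assumes p: "p \<in> M_plus \<times> UNIV" and q: "q \<in> M_plus \<times> UNIV" "q' \<in> M_plus \<times> UNIV"
    and inv: "inverse_pair p q" "inverse_pair p q'"
  shows "q = q'"
proof -
  obtain l c m d m' d' where eq: "p = (l, c)" "q = (m, d)" "q' = (m', d')"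
    by (cases p; cases q; cases q')
  have mem: "l \<in> M_plus" "m \<in> M_plus" "m' \<in> M_plus" using p q eq by auto
  have 1: "cauchy_fps c l * cauchy_fps d m = 1" "cauchy_fps c l * cauchy_fps d' m' = 1"
    using inverse_pair_imp_cauchy_fps_mult mem inv unfolding eq by blast+
  have "cauchy_fps d m = cauchy_fps d m * (cauchy_fps c l * cauchy_fps d' m')" using 1 by simp
  also have "\<dots> = (cauchy_fps c l * cauchy_fps d m) * cauchy_fps d' m'" by (simp only: mult_ac)
  finally have "cauchy_fps d m = cauchy_fps d' m'" using 1 by simp
  with cauchy_fps_inject mem show ?thesis unfolding eq by blast
qed

lemma B_map_eqI:
  assumes "p \<in> M_plus \<times> UNIV" "q \<in> M_plus \<times> UNIV" "inverse_pair p q"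
  shows "B_map p = q"
  unfolding B_map_def
proof (rule the_equality)
  show "q \<in> M_plus \<times> UNIV \<and> inverse_pair p q" using assms by blast
  show "q' = q" if "q' \<in> M_plus \<times> UNIV \<and> inverse_pair p q'" for q'
    using that by (intro inverse_pair_unique[OF assms(1) _ assms(2) _ assms(3)]) simp_all
qed

lemma B_map_props:
  assumes p: "p \<in> M_plus \<times> UNIV"
  shows "B_map p \<in> M_plus \<times> UNIV" "inverse_pair p (B_map p)"
proof -
  obtain q where q: "q \<in> M_plus \<times> UNIV" "inverse_pair p q"
    using inverse_pair_exists[OF p] by blast
  from B_map_eqI[OF p q] q show "B_map p \<in> M_plus \<times> UNIV" "inverse_pair p (B_map p)" by simp_all
qed

lemma B_map_involution:
  assumes p: "p \<in> M_plus \<times> UNIV"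
  shows "B_map (B_map p) = p"
  using B_map_props[OF p] p inverse_pair_sym by (intro B_map_eqI) blast+

text \<open>Comparing coefficients in \<open>A * B = 1\<close> gives the recursion
  \<open>b\<^sub>n = (\<delta>\<^sub>n - (\<Sum>i<n. a\<^sub>n\<^sub>-\<^sub>i * b\<^sub>i)) / a\<^sub>0\<close>, whose denominator is non-zero, so convergence
  passes from lower to higher coefficients.\<close>
lemma fps_inverse_coeff_tendsto:
  fixes A B :: "'x \<Rightarrow> complex fps"
  assumes prod: "eventually (\<lambda>x. A x * B x = 1) F" and prod': "A' * B' = 1"
    and A: "\<And>n. ((\<lambda>x. A x $ n) \<longlongrightarrow> A' $ n) F"
  shows "((\<lambda>x. B x $ n) \<longlongrightarrow> B' $ n) F"
proof (induction n rule: less_induct)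
  case (less n)
  have coeff: "X $ 0 \<noteq> 0 \<and> Y $ n = ((if n = 0 then 1 else 0) - (\<Sum>i<n. X $ (n - i) * Y $ i)) / X $ 0"
    if "X * Y = 1" for X Y :: "complex fps"
  proof -
    have "X $ 0 * Y $ 0 = 1" using that by (metis fps_mult_nth_0 fps_one_nth)
    then have nz: "X $ 0 \<noteq> 0" by auto
    have "(if n = 0 then 1 else 0) = (Y * X) $ n" using that by (simp add: mult.commute)
    also have "\<dots> = (\<Sum>i\<le>n. Y $ i * X $ (n - i))" by (simp add: fps_mult_nth atLeast0AtMost)
    also have "\<dots> = (\<Sum>i<n. X $ (n - i) * Y $ i) + X $ 0 * Y $ n"
      by (simp add: lessThan_Suc_atMost[symmetric] mult.commute)
    finally show ?thesis using nz by (simp add: field_simps)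
  qed
  have "((\<lambda>x. ((if n = 0 then 1 else 0) - (\<Sum>i<n. A x $ (n - i) * B x $ i)) / A x $ 0) \<longlongrightarrow>
      ((if n = 0 then 1 else 0) - (\<Sum>i<n. A' $ (n - i) * B' $ i)) / A' $ 0) F"
    using coeff[OF prod'] by (intro tendsto_intros A less.IH) auto
  moreover have "eventually (\<lambda>x. B x $ n =
      ((if n = 0 then 1 else 0) - (\<Sum>i<n. A x $ (n - i) * B x $ i)) / A x $ 0) F"
    using prod by eventually_elim (use coeff in blast)
  ultimately show ?case
    using coeff[OF prod'] by (simp add: tendsto_cong)
qed

lemma continuous_map_integral:
  assumes "continuous_on circle f"
  shows "continuous_map weak_topology euclideanreal (\<lambda>M. \<integral>w. f w \<partial>M)"
  unfolding continuous_map_def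
proof (intro conjI allI impI)
  fix U :: "real set" assume "openin euclideanreal U"
  then have "{M \<in> M_plus. (\<integral>w. f w \<partial>M) \<in> U} \<in> {{M \<in> M_plus. (\<integral>w. f w \<partial>M) \<in> U} | (f :: complex \<Rightarrow> real) U.
        continuous_on circle f \<and> open U}"
    using assms by auto
  then show "openin weak_topology {M \<in> topspace weak_topology. (\<integral>w. f w \<partial>M) \<in> U}"
    unfolding topspace_weak_topology unfolding weak_topology_def by (rule topology_generated_by_Basis)
qed auto

text \<open>The universal property of an initial topology.\<close>
lemma continuous_map_into_weak_topology:
  assumes into: "g ` topspace X \<subseteq> M_plus"
    and cont: "\<And>f :: complex \<Rightarrow> real. continuous_on circle f \<Longrightarrow>
      continuous_map X euclideanreal (\<lambda>x. \<integral>w. f w \<partial>g x)"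
  shows "continuous_map X weak_topology g"
  unfolding weak_topology_def
proof (rule continuous_on_generated_topo)
  fix V assume "V \<in> {{M \<in> M_plus. (\<integral>w. f w \<partial>M) \<in> U} | (f :: complex \<Rightarrow> real) U.
        continuous_on circle f \<and> open U}"
  then obtain f :: "complex \<Rightarrow> real" and U where V: "V = {M \<in> M_plus. (\<integral>w. f w \<partial>M) \<in> U}"
    and f: "continuous_on circle f" and U: "open U" by blast
  have "g -` V \<inter> topspace X = {x \<in> topspace X. (\<integral>w. f w \<partial>g x) \<in> U}"
    using into V by auto
  then show "openin X (g -` V \<inter> topspace X)"
    using openin_continuous_map_preimage[OF cont[OF f]] U by simp
next
  show "g ` topspace X \<subseteq> \<Union> {{M \<in> M_plus. (\<integral>w. f w \<partial>M) \<in> U} | (f :: complex \<Rightarrow> real) U.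
        continuous_on circle f \<and> open U}"
    using into topspace_weak_topology
    unfolding weak_topology_def topology_generated_by_topspace by simp
qed

lemma topspace_weak_product: "topspace (prod_topology weak_topology euclideanreal) = M_plus \<times> UNIV"
  by (simp add: topspace_weak_topology)

lemma eventually_atin_topspace: "eventually (\<lambda>y. y \<in> topspace X) (atin X x)"
  by (auto simp: eventually_atin)

text \<open>The weak topology tests against real functions, so the real and the imaginary part of the
  moment are treated separately.\<close>
lemma moment_tendsto_weak:
  assumes "continuous_map X weak_topology g" "x \<in> topspace X"
  shows "((\<lambda>y. moment (g y) n) \<longlongrightarrow> moment (g x) n) (atin X x)"
proof -
  have g: "g y \<in> M_plus" if "y \<in> topspace X" for y
    using assms(1) that topspace_weak_topology by (auto simp: continuous_map_def)
  have lim: "((\<lambda>y. \<integral>w. f w \<partial>g y) \<longlongrightarrow> (\<integral>w. f w \<partial>g x)) (atin X x)"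
    if "continuous_on circle f" for f :: "complex \<Rightarrow> real"
    using continuous_map_compose[OF assms(1) continuous_map_integral[OF that]] assms(2)
    by (auto simp: continuous_map_atin o_def)
  have mom: "moment M n = Complex (\<integral>w. Re (cnj w ^ n) \<partial>M) (\<integral>w. Im (cnj w ^ n) \<partial>M)"
    if M: "M \<in> M_plus" for M
  proof -
    have "integrable M (\<lambda>w. cnj w ^ n)"
      by (intro integrable_continuous_on_circle[OF M] continuous_intros)
    then show ?thesis by (simp add: moment_def complex_eq_iff)
  qed
  have "((\<lambda>y. Complex (\<integral>w. Re (cnj w ^ n) \<partial>g y) (\<integral>w. Im (cnj w ^ n) \<partial>g y)) \<longlongrightarrow>
      Complex (\<integral>w. Re (cnj w ^ n) \<partial>g x) (\<integral>w. Im (cnj w ^ n) \<partial>g x)) (atin X x)"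
    by (intro tendsto_Complex lim continuous_intros)
  moreover have "eventually (\<lambda>y. moment (g y) n
      = Complex (\<integral>w. Re (cnj w ^ n) \<partial>g y) (\<integral>w. Im (cnj w ^ n) \<partial>g y)) (atin X x)"
    using eventually_atin_topspace by eventually_elim (intro mom g)
  ultimately show ?thesis
    unfolding mom[OF g[OF assms(2)]] by (simp add: tendsto_cong)
qed

text \<open>The coefficients of the Cauchy transform of \<open>p\<close> depend continuously on \<open>p\<close>, hence so do those of
  its inverse, which is the Cauchy transform of \<open>B_map p\<close>. Their limits control the moments of the
  image measure, hence the integrals that define the weak topology, and the imaginary part of the
  constant coefficient is the second component.\<close>
lemma continuous_map_B_map:
  "continuous_map (prod_topology weak_topology euclideanreal)
     (prod_topology weak_topology euclideanreal) B_map"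
proof -
  let ?X = "prod_topology weak_topology euclideanreal"
  define A where "A p = cauchy_fps (snd p) (fst p)" for p
  have AB: "A p * A (B_map p) = 1" if "p \<in> M_plus \<times> UNIV" for p
    using inverse_pair_imp_cauchy_fps_mult[of "fst p" "fst (B_map p)" "snd p" "snd (B_map p)"]
      B_map_props[OF that] that by (simp add: A_def mem_Times_iff)
  have ev: "eventually (\<lambda>y. y \<in> M_plus \<times> UNIV) (atin ?X p)" for p
    using eventually_atin_topspace[of ?X p] unfolding topspace_weak_product .
  have mem: "fst (B_map p) \<in> M_plus" if "p \<in> M_plus \<times> UNIV" for p
    using B_map_props(1)[OF that] by (simp add: mem_Times_iff)
  have limA: "((\<lambda>y. A y $ n) \<longlongrightarrow> A p $ n) (atin ?X p)" if p: "p \<in> M_plus \<times> UNIV" for p n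
  proof -
    have pX: "p \<in> topspace ?X" using p by (simp add: topspace_weak_topology)
    have mom: "((\<lambda>y. moment (fst y) n) \<longlongrightarrow> moment (fst p) n) (atin ?X p)" for n
      by (rule moment_tendsto_weak[OF continuous_map_fst pX])
    have snd: "((\<lambda>y. snd y) \<longlongrightarrow> snd p) (atin ?X p)"
      using continuous_map_snd[of weak_topology euclideanreal] pX by (auto simp: continuous_map_atin)
    show ?thesis
    proof (cases "n = 0")
      case True
      have "((\<lambda>y. Complex (Re (moment (fst y) 0)) (snd y)) \<longlongrightarrow>
          Complex (Re (moment (fst p) 0)) (snd p)) (atin ?X p)"
        by (intro tendsto_Complex tendsto_Re mom snd)
      then show ?thesis using True by (simp add: A_def cauchy_fps_nth_0 moment_0)
    next
      case False
      then show ?thesis using tendsto_mult_left[OF mom, of 2] by (simp add: A_def cauchy_fps_nth)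
    qed
  qed
  have limB: "((\<lambda>y. A (B_map y) $ n) \<longlongrightarrow> A (B_map p) $ n) (atin ?X p)"
    if p: "p \<in> M_plus \<times> UNIV" for p n
    by (rule fps_inverse_coeff_tendsto[OF _ AB[OF p] limA[OF p]])
      (rule eventually_mono[OF ev AB])
  have snd: "continuous_map ?X euclideanreal (snd \<circ> B_map)"
    unfolding continuous_map_atin topspace_weak_product
  proof
    fix p :: "complex measure \<times> real" assume "p \<in> M_plus \<times> UNIV"
    from tendsto_Im[OF limB[OF this, of 0]]
    show "limitin euclideanreal (snd \<circ> B_map) ((snd \<circ> B_map) p) (atin ?X p)"
      by (simp add: A_def cauchy_fps_nth_0 o_def)
  qed
  have fst: "continuous_map ?X weak_topology (fst \<circ> B_map)"
  proof (rule continuous_map_into_weak_topology)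
    show "(fst \<circ> B_map) ` topspace ?X \<subseteq> M_plus" unfolding topspace_weak_product using mem by auto
    fix f :: "complex \<Rightarrow> real" assume f: "continuous_on circle f"
    show "continuous_map ?X euclideanreal (\<lambda>p. \<integral>w. f w \<partial>(fst \<circ> B_map) p)"
      unfolding continuous_map_atin topspace_weak_product
    proof
      fix p :: "complex measure \<times> real" assume p: "p \<in> M_plus \<times> UNIV"
      have mom: "((\<lambda>y. moment (fst (B_map y)) n) \<longlongrightarrow> moment (fst (B_map p)) n) (atin ?X p)" for n
      proof (cases "n = 0")
        case True
        show ?thesis
          using tendsto_of_real[OF tendsto_Re[OF limB[OF p, of 0]], where 'a = complex]
          by (simp add: True A_def cauchy_fps_nth_0 moment_0)
      next
        case False
        then show ?thesis
          using tendsto_divide[OF limB[OF p, of n] tendsto_const, of 2]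
          by (simp add: A_def cauchy_fps_nth)
      qed
      have "((\<lambda>y. \<integral>w. f w \<partial>fst (B_map y)) \<longlongrightarrow> (\<integral>w. f w \<partial>fst (B_map p))) (atin ?X p)"
        by (rule moments_tendsto_imp_integral_tendsto[OF eventually_mono[OF ev mem] mem[OF p] mom f])
      then show "limitin euclideanreal (\<lambda>p. \<integral>w. f w \<partial>(fst \<circ> B_map) p)
          (\<integral>w. f w \<partial>(fst \<circ> B_map) p) (atin ?X p)" by simp
    qed
  qed
  show ?thesis using fst snd by (simp add: continuous_map_pairwise)
qed

theorem theorem4p1:
  shows "(\<forall>c\<^sub>0 :: real. \<forall>l \<in> M_plus. \<exists>!(\<zeta>\<^sub>0 :: real, m). m \<in> M_plus \<and>
            (\<forall>z \<in> ball 0 1. cauchy_transform c\<^sub>0 l z * cauchy_transform \<zeta>\<^sub>0 m z = 1)) \<and>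
         (\<forall>p \<in> M_plus \<times> UNIV. B_map p \<in> M_plus \<times> UNIV \<and> B_map (B_map p) = p) \<and>
         continuous_map (prod_topology weak_topology euclideanreal)
           (prod_topology weak_topology euclideanreal) B_map \<and>
         (\<forall>l \<in> M_plus. \<forall>c\<^sub>0 m \<zeta>\<^sub>0. B_map (l, c\<^sub>0) = (m, \<zeta>\<^sub>0) \<longrightarrow>
            Complex (tv_norm l) c\<^sub>0 * Complex (tv_norm m) \<zeta>\<^sub>0 = 1)"
proof (intro conjI ballI allI impI)
  fix c :: real and l :: "complex measure" assume l: "l \<in> M_plus"
  then have p: "(l, c) \<in> M_plus \<times> UNIV" by simp
  let ?P = "\<lambda>(d :: real, m). m \<in> M_plus \<and>
            (\<forall>z \<in> ball 0 1. cauchy_transform c l z * cauchy_transform d m z = 1)"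
  have P: "?P (d, m) \<longleftrightarrow> (m, d) \<in> M_plus \<times> UNIV \<and> inverse_pair (l, c) (m, d)" for d m
    by (simp add: inverse_pair_def)
  obtain m d where q: "(m, d) \<in> M_plus \<times> UNIV" "inverse_pair (l, c) (m, d)"
    using inverse_pair_exists[OF p] by blast
  show "\<exists>!x. ?P x"
  proof (rule ex1I)
    show "?P (d, m)" by (rule P[THEN iffD2]) (intro conjI q)
    fix x assume x: "?P x"
    obtain d' m' where x_eq: "x = (d', m')" by (rule prod.exhaust)
    have q': "(m', d') \<in> M_plus \<times> UNIV \<and> inverse_pair (l, c) (m', d')"
      using x unfolding x_eq by (rule P[THEN iffD1])
    have "(m', d') = (m, d)"
      by (rule inverse_pair_unique[OF p conjunct1[OF q'] q(1) conjunct2[OF q'] q(2)])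
    then show "x = (d, m)" unfolding x_eq by simp
  qed
next
  fix p :: "complex measure \<times> real" assume p: "p \<in> M_plus \<times> UNIV"
  show "B_map p \<in> M_plus \<times> UNIV" by (rule B_map_props(1)[OF p])
  show "B_map (B_map p) = p" by (rule B_map_involution[OF p])
next
  show "continuous_map (prod_topology weak_topology euclideanreal)
           (prod_topology weak_topology euclideanreal) B_map"
    by (rule continuous_map_B_map)
next
  fix l c m d assume l: "l \<in> M_plus" and B: "B_map (l, c) = (m, d)"
  then have p: "(l, c) \<in> M_plus \<times> UNIV" by simp
  from B_map_props[OF p] have m: "m \<in> M_plus" and pair: "inverse_pair (l, c) (m, d)"
    unfolding B by simp_all
  have "cauchy_transform c l 0 * cauchy_transform d m 0 = 1"
    using pair unfolding inverse_pair_def by simp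
  then show "Complex (tv_norm l) c * Complex (tv_norm m) d = 1"
    unfolding cauchy_transform_0[OF l] cauchy_transform_0[OF m] tv_norm_eq_mass[OF l] tv_norm_eq_mass[OF m] .
qed

end
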